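(* Let $d\ge 1$ and $n\ge 1$ be integers and let $\mathcal B_d(n)$ denote the set of all $d$-ary trees with $n$ vertices. Then $$\sum_{\tau\in\mathcal B_d(n)}\frac{n!}{\prod_{v\in\tau}|\tau^{(v)}|\,d^{|\tau^{(v)}|-1}}=1.$$
   Context: A $d$-ary tree is a finite set $\tau$ of finite words over the alphabet $\{1,\dots,d\}$ that contains the empty word and is closed under taking prefixes (so the $d$ possible children positions of each vertex are distinguished); its vertices are its elements. For $v\in\tau$, $\tau^{(v)}=\{u: vu\in\tau\}$ (where $vu$ is concatenation), so $|\tau^{(v)}|$ is the number of descendants of $v$ in $\tau$, including $v$. The product is over all $v\in\tau$ of the whole expression $|\tau^{(v)}|\,d^{|\tau^{(v)}|-1}$. *)

theory Defs
  imports Complex_Main "HOL-Library.Sublist"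
begin

definition dary_tree :: "nat \<Rightarrow> nat list set \<Rightarrow> bool" where
  "dary_tree d t \<longleftrightarrow>
     finite t \<and> t \<subseteq> lists {1..d} \<and> [] \<in> t \<and> (\<forall>v\<in>t. \<forall>u. prefix u v \<longrightarrow> u \<in> t)"

definition dary_trees :: "nat \<Rightarrow> nat \<Rightarrow> nat list set set" where
  "dary_trees d n = {t. dary_tree d t \<and> card t = n}"

definition subtree_at :: "nat list set \<Rightarrow> nat list \<Rightarrow> nat list set" where
  "subtree_at t v = {u. v @ u \<in> t}"

end

theory Submission
  imports Defs "HOL-Library.FuncSet"
begin

text \<open>
  A nonempty tree is a root together with a \<open>d\<close>-tuple of possibly empty branches, and the hook
  product of the tree is the factor of the root times the product of those of the branches. If the
  inverse hook products over all branches of size \<open>k\<close> sum to \<open>1 / k!\<close> for \<open>k < n\<close>, the exponential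
  generating function of the tuples is \<open>exp x ^ d = exp (d x)\<close>, so trees of size \<open>n\<close> contribute
  \<open>1 / (n d ^ (n - 1)) * d ^ (n - 1) / (n - 1)! = 1 / n!\<close>.
\<close>

text \<open>Coefficient of \<open>x ^ m\<close> in \<open>exp x ^ card I = exp (card I * x)\<close>,
  by induction on \<open>I\<close>. The hypothesis is asked only for \<open>k \<le> m\<close>, so
  that the finite set \<open>A\<close> may be cut off at size \<open>m\<close>. \<open>m\<close>
  varies in the induction because fixing one component lowers the remaining total.\<close>

lemma sum_prod_PiE_exp_weights:
  fixes w :: "'a \<Rightarrow> real" and s :: "'a \<Rightarrow> nat"
  assumes "finite I" and "finite A"
    and "\<And>k. k \<le> m \<Longrightarrow> (\<Sum>x\<in>{x\<in>A. s x = k}. w x) = 1 / fact k"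
  shows "(\<Sum>f\<in>{f\<in>I \<rightarrow>\<^sub>E A. (\<Sum>i\<in>I. s (f i)) = m}. \<Prod>i\<in>I. w (f i)) = real (card I) ^ m / fact m"
  using assms(1,3)
proof (induction I arbitrary: m rule: finite_induct)
  case empty
  show ?case
  proof (cases "m = 0")
    case True
    \<comment> \<open>The empty tuple has total 0 and product 1, matching \<open>0 ^ 0 = 1\<close>;
      for \<open>m > 0\<close> both sides vanish.\<close>
    then have "{f \<in> {} \<rightarrow>\<^sub>E A. (\<Sum>i\<in>{}. s (f i)) = m} = {\<lambda>x. undefined}" by auto
    with True show ?thesis by simp
  qed simp
next
  case (insert i I)
  have fin: "finite (I \<rightarrow>\<^sub>E A)"
    using insert.hyps assms(2) by (simp add: finite_PiE)
  define c where "c = real (card I)"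
  \<comment> \<open>Once \<open>x\<close> is placed at index \<open>i\<close>, the other components
    must have total \<open>m - s x\<close>. The guard \<open>s x \<le> m\<close> keeps this
    subtraction honest; if it fails, no \<open>g\<close> meets the condition.\<close>
  have tail: "(\<Sum>g\<in>I \<rightarrow>\<^sub>E A. if s x + (\<Sum>j\<in>I. s (g j)) = m then w x * (\<Prod>j\<in>I. w (g j)) else 0)
      = (if s x \<le> m then w x * (c ^ (m - s x) / fact (m - s x)) else 0)" for x
  proof (cases "s x \<le> m")
    case True
    have "(\<Sum>g\<in>I \<rightarrow>\<^sub>E A. if s x + (\<Sum>j\<in>I. s (g j)) = m then w x * (\<Prod>j\<in>I. w (g j)) else 0)
        = (\<Sum>g\<in>{g \<in> I \<rightarrow>\<^sub>E A. (\<Sum>j\<in>I. s (g j)) = m - s x}. w x * (\<Prod>j\<in>I. w (g j)))"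
      using fin True by (simp add: sum.inter_filter) (intro sum.cong refl if_cong, auto)
    also have "\<dots> = w x * (c ^ (m - s x) / fact (m - s x))"
      using insert.IH[of "m - s x"] insert.prems by (simp add: c_def flip: sum_distrib_left)
    finally show ?thesis using True by simp
  qed simp
  have "(\<Sum>f\<in>{f\<in>insert i I \<rightarrow>\<^sub>E A. (\<Sum>j\<in>insert i I. s (f j)) = m}. \<Prod>j\<in>insert i I. w (f j))
      = (\<Sum>f\<in>insert i I \<rightarrow>\<^sub>E A. if (\<Sum>j\<in>insert i I. s (f j)) = m then \<Prod>j\<in>insert i I. w (f j) else 0)"
    using insert.hyps assms(2) by (intro sum.inter_filter) (simp add: finite_PiE)
  also have "\<dots> = (\<Sum>(x, g)\<in>A \<times> (I \<rightarrow>\<^sub>E A).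
      if s x + (\<Sum>j\<in>I. s (g j)) = m then w x * (\<Prod>j\<in>I. w (g j)) else 0)"
  proof -
    \<comment> \<open>Since \<open>i\<close> lies outside \<open>I\<close>, the value placed at
      \<open>i\<close> does not affect sums and products over \<open>I\<close>.\<close>
    have upd: "(\<Sum>j\<in>I. s (if j = i then x else g j)) = (\<Sum>j\<in>I. s (g j))"
      "(\<Prod>j\<in>I. w (if j = i then x else g j)) = (\<Prod>j\<in>I. w (g j))" for x g
      using insert.hyps by (auto intro!: sum.cong prod.cong)
    show ?thesis
      unfolding PiE_insert_eq
      using insert.hyps inj_combinator[of i I "\<lambda>_. A"]
      by (subst sum.reindex) (auto simp: case_prod_unfold upd intro!: sum.cong)
  qed
  also have "\<dots> = (\<Sum>x\<in>A. if s x \<le> m then w x * (c ^ (m - s x) / fact (m - s x)) else 0)"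
    by (simp add: sum.cartesian_product[symmetric] tail)
  also have "\<dots> = (\<Sum>x\<in>{x\<in>A. s x \<le> m}. w x * (c ^ (m - s x) / fact (m - s x)))"
    by (intro sum.inter_filter[symmetric] assms(2))
  \<comment> \<open>Grouping by the size \<open>k\<close> of the new component lets the hypothesis
    replace each group by \<open>1 / fact k\<close>.\<close>
  also have "\<dots> = (\<Sum>k\<le>m. \<Sum>x\<in>{x\<in>{x\<in>A. s x \<le> m}. s x = k}. w x * (c ^ (m - s x) / fact (m - s x)))"
    using assms(2) by (intro sum.group[symmetric]) auto
  also have "\<dots> = (\<Sum>k\<le>m. (\<Sum>x\<in>{x\<in>A. s x = k}. w x) * (c ^ (m - k) / fact (m - k)))"
    unfolding sum_distrib_right by (intro sum.cong) auto
  \<comment> \<open>The factor \<open>1 ^ k\<close> puts the sum into the shape of the binomial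
    expansion of \<open>(1 + c) ^ m\<close>, where \<open>1 + c\<close> is the size of
    \<open>insert i I\<close>.\<close>
  also have "\<dots> = (\<Sum>k\<le>m. of_nat (m choose k) * 1 ^ k * c ^ (m - k)) / fact m"
    unfolding sum_divide_distrib
    by (intro sum.cong) (simp_all add: insert.prems binomial_fact field_simps)
  also have "\<dots> = real (card (insert i I)) ^ m / fact m"
    using insert.hyps by (simp only: binomial_ring[symmetric]) (simp add: c_def)
  finally show ?case .
qed

text \<open>The empty set stands for a vacant child position, so every root has exactly
  \<open>d\<close> branches.\<close>

definition branches :: "nat \<Rightarrow> nat list set set" where
  "branches d = {t. t = {} \<or> dary_tree d t}"

definition root_join :: "nat \<Rightarrow> (nat \<Rightarrow> nat list set) \<Rightarrow> nat list set" where
  "root_join d f = insert [] (\<Union>i\<in>{1..d}. Cons i ` f i)"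

text \<open>The empty branch gets weight 1, so vacant positions do not alter products. In a finite
  tree each vertex lies above at least itself, so the exponent is never truncated.\<close>

definition hook_weight :: "nat \<Rightarrow> nat list set \<Rightarrow> real" where
  "hook_weight d t =
     (\<Prod>v\<in>t. 1 / (real (card (subtree_at t v)) * real d ^ (card (subtree_at t v) - 1)))"

lemma finite_branch: "t \<in> branches d \<Longrightarrow> finite t"
  by (auto simp: branches_def dary_tree_def)

text \<open>In a nonempty prefix-closed set the empty word is automatic, which removes the case
  distinction.\<close>

lemma branches_iff:
  "t \<in> branches d \<longleftrightarrow> finite t \<and> t \<subseteq> lists {1..d} \<and> (\<forall>v\<in>t. \<forall>u. prefix u v \<longrightarrow> u \<in> t)"
  by (auto simp: branches_def dary_tree_def)

lemma dary_trees_eq_branches: "n \<ge> 1 \<Longrightarrow> dary_trees d n = {t \<in> branches d. card t = n}"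
  by (auto simp: branches_def dary_trees_def)

text \<open>The \<open>length v + 1\<close> prefixes of \<open>v\<close> are distinct
  vertices.\<close>

lemma length_less_card_branch:
  assumes "t \<in> branches d" and "v \<in> t"
  shows "length v < card t"
proof -
  have "set (prefixes v) \<subseteq> t"
    using assms by (auto simp: branches_iff)
  then have "card (set (prefixes v)) \<le> card t"
    using finite_branch[OF assms(1)] by (rule card_mono[rotated])
  then show ?thesis by (simp add: distinct_card)
qed

lemma finite_branches_card_le: "finite {t \<in> branches d. card t \<le> m}"
proof (rule finite_subset)
  show "{t \<in> branches d. card t \<le> m} \<subseteq> Pow {v. set v \<subseteq> {1..d} \<and> length v \<le> m}"
  proof (intro subsetI PowI)
    fix t v assume t: "t \<in> {t \<in> branches d. card t \<le> m}" and v: "v \<in> t"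
    then have "set v \<subseteq> {1..d}"
      by (auto simp: branches_iff)
    moreover have "length v \<le> m"
      using length_less_card_branch[of t d v] t v by simp
    ultimately show "v \<in> {v. set v \<subseteq> {1..d} \<and> length v \<le> m}" by simp
  qed
  show "finite (Pow {v. set v \<subseteq> {1..d} \<and> length v \<le> m})"
    by (simp add: finite_lists_length_le)
qed

lemma finite_root_join:
  "(\<And>i. i \<in> {1..d} \<Longrightarrow> finite (f i)) \<Longrightarrow> finite (root_join d f)"
  by (simp add: root_join_def)

lemma card_root_join:
  assumes "\<And>i. i \<in> {1..d} \<Longrightarrow> finite (f i)"
  shows "card (root_join d f) = Suc (\<Sum>i\<in>{1..d}. card (f i))"
proof -
  have "card (\<Union>i\<in>{1..d}. Cons i ` f i) = (\<Sum>i\<in>{1..d}. card (Cons i ` f i))"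
    using assms by (intro card_UN_disjoint) auto
  then show ?thesis
    unfolding root_join_def using assms by (subst card_insert_disjoint) (auto simp: card_image)
qed

lemma subtree_at_root_join:
  "i \<in> {1..d} \<Longrightarrow> subtree_at (root_join d f) (i # v) = subtree_at (f i) v"
  by (auto simp: subtree_at_def root_join_def)

text \<open>The root sees all \<open>Suc m\<close> vertices. Any other vertex \<open>i # v\<close>
  sees the same descendants as \<open>v\<close> does in \<open>f i\<close>, so the remaining factors
  regroup by first letter.\<close>

lemma hook_weight_root_join:
  assumes "\<And>i. i \<in> {1..d} \<Longrightarrow> finite (f i)"
    and "(\<Sum>i\<in>{1..d}. card (f i)) = m"
  shows "hook_weight d (root_join d f)
    = 1 / (real (Suc m) * real d ^ m) * (\<Prod>i\<in>{1..d}. hook_weight d (f i))"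
proof -
  define h where "h = (\<lambda>t v. 1 / (real (card (subtree_at t v)) * real d ^ (card (subtree_at t v) - 1)))"
  have "hook_weight d (root_join d f)
      = h (root_join d f) [] * (\<Prod>v\<in>(\<Union>i\<in>{1..d}. Cons i ` f i). h (root_join d f) v)"
  proof -
    have "hook_weight d (root_join d f) = prod (h (root_join d f)) (root_join d f)"
      by (simp add: hook_weight_def h_def)
    also have "root_join d f = insert [] (\<Union>i\<in>{1..d}. Cons i ` f i)"
      by (rule root_join_def)
    finally show ?thesis
      using assms(1) by (subst (asm) prod.insert) (auto simp: root_join_def)
  qed
  also have "h (root_join d f) [] = 1 / (real (Suc m) * real d ^ m)"
    using card_root_join[of d f] assms by (simp add: h_def subtree_at_def)
  also have "(\<Prod>v\<in>(\<Union>i\<in>{1..d}. Cons i ` f i). h (root_join d f) v)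
      = (\<Prod>i\<in>{1..d}. \<Prod>v\<in>Cons i ` f i. h (root_join d f) v)"
    using assms(1) by (intro prod.UNION_disjoint) auto
  also have "\<dots> = (\<Prod>i\<in>{1..d}. hook_weight d (f i))"
    by (intro prod.cong refl)
      (simp add: prod.reindex hook_weight_def h_def subtree_at_root_join del: atLeastAtMost_iff)
  finally show ?thesis .
qed

lemma root_join_in_branches:
  assumes "\<And>i. i \<in> {1..d} \<Longrightarrow> f i \<in> branches d"
  shows "root_join d f \<in> branches d"
  unfolding branches_iff
proof (intro conjI ballI allI impI)
  show "finite (root_join d f)"
    using assms finite_branch by (intro finite_root_join) blast
  have mem: "i # v \<in> lists {1..d}" if "i \<in> {1..d}" "v \<in> f i" for i v
    using assms[OF that(1)] that by (auto simp: branches_iff)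
  show "root_join d f \<subseteq> lists {1..d}"
  proof
    fix v assume "v \<in> root_join d f"
    then consider "v = []" | i u where "i \<in> {1..d}" "u \<in> f i" "v = i # u"
      unfolding root_join_def by blast
    then show "v \<in> lists {1..d}"
      by cases (simp_all only: lists.Nil mem)
  qed
  show "u \<in> root_join d f" if "v \<in> root_join d f" "prefix u v" for u v
  proof (cases u)
    case (Cons i u')
    with that obtain v' where i: "i \<in> {1..d}" "v' \<in> f i" "prefix u' v'"
      unfolding root_join_def by (auto simp del: atLeastAtMost_iff)
    then have "u' \<in> f i"
      using assms unfolding branches_iff by blast
    with i Cons show ?thesis
      unfolding root_join_def by blast
  qed (simp add: root_join_def)
qed

text \<open>No word of \<open>t\<close> starts with a letter outside \<open>{1..d}\<close>, so the
  restricted tuple loses nothing; the restriction makes it an element of the extensional function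
  space.\<close>

lemma root_join_surj:
  assumes "t \<in> branches d" and "t \<noteq> {}"
  shows "root_join d (\<lambda>i\<in>{1..d}. {u. i # u \<in> t}) = t"
proof (rule set_eqI)
  fix v
  show "v \<in> root_join d (\<lambda>i\<in>{1..d}. {u. i # u \<in> t}) \<longleftrightarrow> v \<in> t"
  proof (cases v)
    case Nil
    with assms show ?thesis by (auto simp: root_join_def branches_def dary_tree_def)
  next
    case (Cons i u)
    have "i \<in> {1..d}" if "i # u \<in> t"
      using that assms(1) by (auto simp: branches_iff)
    with Cons show ?thesis by (auto simp: root_join_def)
  qed
qed

lemma branch_below_root:
  assumes "t \<in> branches d"
  shows "{u. i # u \<in> t} \<in> branches d"
proof -
  have "finite {u. i # u \<in> t}"
    using finite_vimageI[OF finite_branch[OF assms], of "Cons i"] by (simp add: vimage_def)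
  moreover have "{u. i # u \<in> t} \<subseteq> lists {1..d}"
    using assms unfolding branches_iff by (auto simp: subset_iff)
  moreover have "u \<in> {u. i # u \<in> t}" if "v \<in> {u. i # u \<in> t}" "prefix u v" for u v
  proof -
    have "i # v \<in> t" "prefix (i # u) (i # v)" using that by simp_all
    with assms show ?thesis unfolding branches_iff by blast
  qed
  ultimately show ?thesis
    unfolding branches_iff by blast
qed

text \<open>The inverse collects the words below each first letter. Extensionality makes the tuple
  unique. The bound \<open>card t \<le> m\<close> follows from the total being \<open>m\<close>; it
  is stated to keep the set of candidate branches finite.\<close>

lemma bij_betw_root_join:
  "bij_betw (root_join d)
     {f \<in> {1..d} \<rightarrow>\<^sub>E {t \<in> branches d. card t \<le> m}. (\<Sum>i\<in>{1..d}. card (f i)) = m}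
     {t \<in> branches d. card t = Suc m}"
  (is "bij_betw _ ?F ?T")
proof (rule bij_betw_imageI)
  show "inj_on (root_join d) ?F"
  proof (rule inj_onI)
    fix f g assume f: "f \<in> ?F" and g: "g \<in> ?F" and eq: "root_join d f = root_join d g"
    show "f = g"
    proof (rule PiE_ext[of f "{1..d}" "\<lambda>_. {t \<in> branches d. card t \<le> m}"])
      fix i assume "i \<in> {1..d}"
      then have "u \<in> f i \<longleftrightarrow> i # u \<in> root_join d f" "u \<in> g i \<longleftrightarrow> i # u \<in> root_join d g" for u
        by (auto simp: root_join_def)
      with eq show "f i = g i" by auto
    qed (use f g in auto)
  qed
  show "root_join d ` ?F = ?T"
  proof (intro equalityI subsetI)
    fix t assume "t \<in> root_join d ` ?F"
    then obtain f where f: "f \<in> ?F" and t: "t = root_join d f" by blast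
    then have br: "f i \<in> branches d" if "i \<in> {1..d}" for i
      using that by (auto simp: PiE_iff)
    then have "card t = Suc (\<Sum>i\<in>{1..d}. card (f i))" "t \<in> branches d"
      unfolding t using finite_branch by (blast intro: card_root_join root_join_in_branches)+
    with f show "t \<in> ?T" by simp
  next
    fix t assume "t \<in> ?T"
    then have t: "t \<in> branches d" "card t = Suc m" "t \<noteq> {}" by auto
    define f where "f = (\<lambda>i\<in>{1..d}. {u. i # u \<in> t})"
    have br: "f i \<in> branches d" if "i \<in> {1..d}" for i
      using that t branch_below_root by (simp add: f_def)
    have join: "root_join d f = t"
      unfolding f_def using t by (intro root_join_surj)
    have "card (root_join d f) = Suc (\<Sum>i\<in>{1..d}. card (f i))"
      using br finite_branch by (intro card_root_join) blast
    with join t have "(\<Sum>i\<in>{1..d}. card (f i)) = m"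
      by simp
    moreover from this have "card (f i) \<le> m" if "i \<in> {1..d}" for i
      using member_le_sum[OF that, of "\<lambda>i. card (f i)"] by simp
    ultimately have "f \<in> ?F"
      using br by (auto simp: PiE_iff) (simp add: f_def)
    with join show "t \<in> root_join d ` ?F" by blast
  qed
qed

text \<open>Strong induction, as a branch may have any size up to \<open>m = n - 1\<close>. The case
  \<open>n = 0\<close> is included because the empty branch supplies the constant term of the
  exponential series.\<close>

lemma sum_hook_weight_branches:
  assumes "d \<ge> 1"
  shows "(\<Sum>t\<in>{t \<in> branches d. card t = n}. hook_weight d t) = 1 / fact n"
proof (induction n rule: less_induct)
  case (less n)
  show ?case
  proof (cases n)
    case 0
    have "{t \<in> branches d. card t = 0} = {{}}"
      using finite_branch by (auto simp: branches_iff)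
    with 0 show ?thesis by (simp add: hook_weight_def)
  next
    case (Suc m)
    let ?A = "{t \<in> branches d. card t \<le> m}"
    let ?F = "{f \<in> {1..d} \<rightarrow>\<^sub>E ?A. (\<Sum>i\<in>{1..d}. card (f i)) = m}"
    \<comment> \<open>For \<open>k \<le> m\<close> the cutoff in \<open>?A\<close> removes nothing,
      and \<open>k < n\<close> gives the induction hypothesis.\<close>
    have level: "(\<Sum>t\<in>{t\<in>?A. card t = k}. hook_weight d t) = 1 / fact k" if "k \<le> m" for k
    proof -
      have "{t\<in>?A. card t = k} = {t \<in> branches d. card t = k}" using that by auto
      with less[of k] that Suc show ?thesis by simp
    qed
    have "(\<Sum>t\<in>{t \<in> branches d. card t = n}. hook_weight d t)
        = (\<Sum>f\<in>?F. hook_weight d (root_join d f))"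
      unfolding Suc by (rule sum.reindex_bij_betw[OF bij_betw_root_join, symmetric])
    also have "\<dots> = (\<Sum>f\<in>?F. 1 / (real (Suc m) * real d ^ m) * (\<Prod>i\<in>{1..d}. hook_weight d (f i)))"
      by (intro sum.cong refl hook_weight_root_join)
        (auto simp: PiE_iff intro!: finite_branch[of _ d])
    also have "\<dots> = 1 / (real (Suc m) * real d ^ m) * (real d ^ m / fact m)"
      using sum_prod_PiE_exp_weights[of "{1..d}" ?A m "hook_weight d" card, OF _ _ level]
      by (simp only: sum_distrib_left[symmetric] finite_branches_card_le finite_atLeastAtMost
          card_atLeastAtMost diff_Suc_1)
    \<comment> \<open>As \<open>d\<close> is nonzero, \<open>d ^ m\<close> cancels, leaving
      \<open>Suc m * fact m = fact n\<close> in the denominator.\<close>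
    also have "\<dots> = 1 / fact n"
      using assms Suc by simp
    finally show ?thesis .
  qed
qed

theorem corollary4p1:
  fixes d n :: nat
  assumes "d \<ge> 1" and "n \<ge> 1"
  shows "(\<Sum>t\<in>dary_trees d n.
            (fact n :: real) /
            (\<Prod>v\<in>t. real (card (subtree_at t v)) * real d ^ (card (subtree_at t v) - 1))) = 1"
proof -
  have "(\<Sum>t\<in>dary_trees d n.
            (fact n :: real) /
            (\<Prod>v\<in>t. real (card (subtree_at t v)) * real d ^ (card (subtree_at t v) - 1)))
      = fact n * (\<Sum>t\<in>{t \<in> branches d. card t = n}. hook_weight d t)"
    \<comment> \<open>\<open>n \<ge> 1\<close> excludes the empty branch, so the trees are exactly
      the branches of size \<open>n\<close>.\<close>
    unfolding sum_distrib_left dary_trees_eq_branches[OF assms(2)]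
    by (intro sum.cong refl) (simp add: hook_weight_def prod_dividef)
  then show ?thesis
    using sum_hook_weight_branches[OF assms(1)] by simp
qed

end
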